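(* $(F^1_{USCG}(\widetilde X), H_{\rm end})$ is a completion of $(F^1_{USCB}(X), H_{\rm end})$, where $(F^1_{USCB}(X),H_{\rm end})$ is regarded as a subspace of $(F^1_{USCG}(\widetilde X),H_{\rm end})$ via the isometric embedding $j$ extending each $u$ by $0$ on $\widetilde X\setminus X$. That is, $(F^1_{USCG}(\widetilde X), H_{\rm end})$ is a complete metric space and $j(F^1_{USCB}(X))$ is dense in it.
   Context: $(X,d)$ is a nonempty metric space and $(\widetilde X,\widetilde d)$ is its completion, with $X$ viewed as a (dense) subspace of $\widetilde X$. For any metric space $(Y,\rho)$, $Y\times[0,1]$ carries the metric $\overline\rho((x,\alpha),(y,\beta))=\rho(x,y)+|\alpha-\beta|$; $C(Y)$ and $K(Y)$ denote the sets of nonempty closed, respectively nonempty compact, subsets of $Y$; and $H(A,B)=\max\{\sup_{a\in A}\inf_{b\in B}\overline\rho(a,b),\ \sup_{b\in B}\inf_{a\in A}\overline\rho(a,b)\}$ is the Hausdorff distance on $C(Y\times[0,1])$. A fuzzy set in $Y$ is a function $u:Y\to[0,1]$, with $[u]_\alpha=\{x\in Y:u(x)\ge\alpha\}$ for $\alpha\in(0,1]$ and $[u]_0=\overline{\{x\in Y:u(x)>0\}}$. $F^1_{USC}(Y)$ is the set of fuzzy sets $u$ in $Y$ with $[u]_\alpha\in C(Y)$ for all $\alpha\in[0,1]$; $F^1_{USCB}(Y)=\{u\in F^1_{USC}(Y):[u]_0\in K(Y)\}$; $F^1_{USCG}(Y)=\{u\in F^1_{USC}(Y):[u]_\alpha\in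 K(Y)\text{ for all }\alpha\in(0,1]\}$. The endograph is ${\rm end}\,u=\{(x,t)\in Y\times[0,1]:u(x)\ge t\}$, and $H_{\rm end}(u,v)=H({\rm end}\,u,{\rm end}\,v)$, a metric on $F^1_{USC}(Y)$. For a fuzzy set $u$ in $X$, $j(u)$ is the fuzzy set in $\widetilde X$ with $j(u)(t)=u(t)$ for $t\in X$ and $j(u)(t)=0$ for $t\in\widetilde X\setminus X$. *)

theory Defs
  imports "HOL-Analysis.Analysis"
begin

text \<open>Metric spaces are given by a carrier set and a distance function, as in the locale
  \<^locale>\<open>Metric_space\<close>. A fuzzy set in \<open>Y\<close> is an element of \<^term>\<open>Y \<rightarrow>\<^sub>E {0..1::real}\<close>;
  extensionality (value \<^term>\<open>undefined\<close> off \<open>Y\<close>) makes equality of fuzzy sets coincide with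
  equality on \<open>Y\<close>.\<close>

definition fuzzy_sets :: "'a set \<Rightarrow> ('a \<Rightarrow> real) set" where
  "fuzzy_sets Y = Y \<rightarrow>\<^sub>E {0..1}"

definition cut :: "'a set \<Rightarrow> ('a \<Rightarrow> 'a \<Rightarrow> real) \<Rightarrow> ('a \<Rightarrow> real) \<Rightarrow> real \<Rightarrow> 'a set" where
  "cut Y \<rho> u \<alpha> =
     (if \<alpha> = 0 then Metric_space.mtopology Y \<rho> closure_of {x \<in> Y. u x > 0}
      else {x \<in> Y. u x \<ge> \<alpha>})"

definition nonempty_closed :: "'a set \<Rightarrow> ('a \<Rightarrow> 'a \<Rightarrow> real) \<Rightarrow> 'a set set" where
  "nonempty_closed Y \<rho> = {A. A \<noteq> {} \<and> closedin (Metric_space.mtopology Y \<rho>) A}"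

definition nonempty_compact :: "'a set \<Rightarrow> ('a \<Rightarrow> 'a \<Rightarrow> real) \<Rightarrow> 'a set set" where
  "nonempty_compact Y \<rho> = {A. A \<noteq> {} \<and> compactin (Metric_space.mtopology Y \<rho>) A}"

definition F_USC :: "'a set \<Rightarrow> ('a \<Rightarrow> 'a \<Rightarrow> real) \<Rightarrow> ('a \<Rightarrow> real) set" where
  "F_USC Y \<rho> = {u \<in> fuzzy_sets Y. \<forall>\<alpha>\<in>{0..1}. cut Y \<rho> u \<alpha> \<in> nonempty_closed Y \<rho>}"

definition F_USCB :: "'a set \<Rightarrow> ('a \<Rightarrow> 'a \<Rightarrow> real) \<Rightarrow> ('a \<Rightarrow> real) set" where
  "F_USCB Y \<rho> = {u \<in> F_USC Y \<rho>. cut Y \<rho> u 0 \<in> nonempty_compact Y \<rho>}"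

definition F_USCG :: "'a set \<Rightarrow> ('a \<Rightarrow> 'a \<Rightarrow> real) \<Rightarrow> ('a \<Rightarrow> real) set" where
  "F_USCG Y \<rho> = {u \<in> F_USC Y \<rho>. \<forall>\<alpha>\<in>{0<..1}. cut Y \<rho> u \<alpha> \<in> nonempty_compact Y \<rho>}"

definition endograph :: "'a set \<Rightarrow> ('a \<Rightarrow> real) \<Rightarrow> ('a \<times> real) set" where
  "endograph Y u = {(x, t). x \<in> Y \<and> t \<in> {0..1} \<and> u x \<ge> t}"

definition sum_dist :: "('a \<Rightarrow> 'a \<Rightarrow> real) \<Rightarrow> 'a \<times> real \<Rightarrow> 'a \<times> real \<Rightarrow> real" where
  "sum_dist \<rho> = (\<lambda>(x, \<alpha>) (y, \<beta>). \<rho> x y + \<bar>\<alpha> - \<beta>\<bar>)"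

text \<open>The Hausdorff distance of two closed sets may be infinite, so it is valued in
  \<^typ>\<open>ennreal\<close>.\<close>

definition hausdorff :: "('b \<Rightarrow> 'b \<Rightarrow> real) \<Rightarrow> 'b set \<Rightarrow> 'b set \<Rightarrow> ennreal" where
  "hausdorff \<sigma> A B =
     max (SUP a\<in>A. INF b\<in>B. ennreal (\<sigma> a b)) (SUP b\<in>B. INF a\<in>A. ennreal (\<sigma> a b))"

text \<open>Distances between endographs are finite (at most 1, by \<open>hausdorff_endograph_le_1\<close> below),
  so the conversion to \<^typ>\<open>real\<close> loses nothing.\<close>

definition H_end :: "'a set \<Rightarrow> ('a \<Rightarrow> 'a \<Rightarrow> real) \<Rightarrow> ('a \<Rightarrow> real) \<Rightarrow> ('a \<Rightarrow> real) \<Rightarrow> real" where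
  "H_end Y \<rho> u v = enn2real (hausdorff (sum_dist \<rho>) (endograph Y u) (endograph Y v))"

lemma hausdorff_endograph_le_1:
  assumes "Metric_space Y \<rho>" "u \<in> fuzzy_sets Y" "v \<in> fuzzy_sets Y"
  shows "hausdorff (sum_dist \<rho>) (endograph Y u) (endograph Y v) \<le> 1"
proof -
  interpret Metric_space Y \<rho> by fact
  have base: "(x, 0) \<in> endograph Y w" if "x \<in> Y" "w \<in> fuzzy_sets Y" for x w
    using that by (force simp: endograph_def fuzzy_sets_def PiE_iff)
  have *: "(INF b\<in>endograph Y v. ennreal (sum_dist \<rho> a b)) \<le> 1"
    if "a \<in> endograph Y u" "v \<in> fuzzy_sets Y" for a u v
  proof (rule INF_lower2)
    show "(fst a, 0) \<in> endograph Y v" "ennreal (sum_dist \<rho> a (fst a, 0)) \<le> 1"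
      using that base by (auto simp: endograph_def sum_dist_def split: prod.splits)
  qed
  have sym: "sum_dist \<rho> a b = sum_dist \<rho> b a" for a b
    by (auto simp: sum_dist_def commute abs_minus_commute split: prod.splits)
  have "(INF a\<in>endograph Y u. ennreal (sum_dist \<rho> a b)) \<le> 1" if "b \<in> endograph Y v" for b
    using *[OF that assms(2)] by (simp add: sym[of _ b])
  with * assms(3) show ?thesis
    unfolding hausdorff_def by (auto intro!: SUP_least)
qed

definition zero_extend :: "'a set \<Rightarrow> 'a set \<Rightarrow> ('a \<Rightarrow> real) \<Rightarrow> ('a \<Rightarrow> real)" where
  "zero_extend X Z u = (\<lambda>t\<in>Z. if t \<in> X then u t else 0)"

text \<open>\<open>(N, e)\<close> is a completion of \<open>(M, d)\<close>, where \<open>M\<close> is regarded as a subspace of \<open>N\<close> via \<open>f\<close>.\<close>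

definition is_completion_via ::
  "('a \<Rightarrow> 'b) \<Rightarrow> 'a set \<Rightarrow> ('a \<Rightarrow> 'a \<Rightarrow> real) \<Rightarrow> 'b set \<Rightarrow> ('b \<Rightarrow> 'b \<Rightarrow> real) \<Rightarrow> bool" where
  "is_completion_via f M d N e \<longleftrightarrow>
     Metric_space M d \<and> Metric_space N e \<and> Metric_space.mcomplete N e \<and>
     f \<in> M \<rightarrow> N \<and> (\<forall>x\<in>M. \<forall>y\<in>M. e (f x) (f y) = d x y) \<and>
     Metric_space.mtopology N e closure_of (f ` M) = N"

end

theory Submission
  imports Defs
begin

text \<open>
  The proof avoids endographs and works with grades at points. Since an endograph is closed
  downwards in the second coordinate, the point \<open>(x, u x)\<close> is, among the points of the endograph of
  \<open>u\<close> above \<open>x\<close>, the furthest from the endograph of \<open>v\<close>, and the cheapest way to reach the latter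
  over a point \<open>y\<close> costs \<open>d x y + max 0 (u x - v y)\<close>. So the endograph distance is at most \<open>r\<close> if and
  only if \<open>excess_le\<close> holds with bound \<open>r\<close> in both directions (\<open>H_end_le_iff\<close>). A point of grade \<open>0\<close>
  costs nothing to reach, which is why extending by \<open>0\<close> is an isometry (\<open>H_end_zero_extend\<close>).

  Completeness. The limit of a Cauchy sequence \<open>f\<close> is the fuzzy set \<open>end_limit f\<close> whose endograph is the
  Kuratowski lower limit of the endographs: the grade at \<open>x\<close> is the largest \<open>t\<close> such that eventually
  every \<open>f n\<close> has a grade close to \<open>t\<close>, or above it, close to \<open>x\<close>. It is automatically upper
  semicontinuous and automatically close to the tail of \<open>f\<close> from one side. For the other side, start
  at a point \<open>x\<close> with its grade in \<open>f n\<close> and walk along the sequence with geometrically decreasing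
  steps; completeness of the base space gives an end point, where \<open>end_limit f\<close> has lost little of
  the grade (\<open>excess_le_end_limit_right\<close>). The \<open>\<alpha>\<close>-cuts of the limit are closed, and they lie close
  to the compact \<open>\<alpha>/2\<close>-cuts of the \<open>f n\<close>, hence are totally bounded, hence compact
  (\<open>compact_cut_if_excess_le\<close>); compactness then turns grades arbitrarily close to \<open>1\<close> into a point of
  grade \<open>1\<close>.

  Density. Changing grades below \<open>\<epsilon>\<close> moves the endograph by at most \<open>\<epsilon>\<close>, so only the compact
  \<open>\<epsilon>\<close>-cut matters. It has a finite \<open>\<epsilon>\<close>-net in the dense subspace, and the fuzzy set supported on that
  net whose grade at \<open>y\<close> is the supremum of \<open>u\<close> over the \<open>\<epsilon>\<close>-ball around \<open>y\<close> is close to \<open>u\<close>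
  (\<open>finite_support_approximation\<close>).
\<close>

section \<open>The endograph distance without endographs\<close>

text \<open>The one-sided Hausdorff distance from the endograph of \<open>u\<close> to that of \<open>v\<close> is at most \<open>r\<close>; the
  slack \<open>e\<close> stands for an infimum over \<open>y\<close> that need not be attained.\<close>

definition excess_le ::
    "'a set \<Rightarrow> ('a \<Rightarrow> 'a \<Rightarrow> real) \<Rightarrow> ('a \<Rightarrow> real) \<Rightarrow> ('a \<Rightarrow> real) \<Rightarrow> real \<Rightarrow> bool" where
  "excess_le Y \<rho> u v r \<longleftrightarrow> (\<forall>x\<in>Y. \<forall>e>0. \<exists>y\<in>Y. \<rho> x y + max 0 (u x - v y) < r + e)"

lemma fuzzy_setsD: "u \<in> fuzzy_sets Y \<Longrightarrow> x \<in> Y \<Longrightarrow> 0 \<le> u x \<and> u x \<le> 1"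
  by (auto simp: fuzzy_sets_def PiE_iff)

lemma INF_ennreal_le_iff:
  assumes "\<And>b. b \<in> B \<Longrightarrow> 0 \<le> g b" "0 \<le> r"
  shows "(INF b\<in>B. ennreal (g b)) \<le> ennreal r \<longleftrightarrow> (\<forall>e>0. \<exists>b\<in>B. g b < r + e)"
proof
  assume L: "(INF b\<in>B. ennreal (g b)) \<le> ennreal r"
  show "\<forall>e>0. \<exists>b\<in>B. g b < r + e"
  proof (intro allI impI)
    fix e :: real assume "e > 0"
    then have "(INF b\<in>B. ennreal (g b)) < ennreal (r + e)"
      using L assms(2) by (meson ennreal_lessI le_less_trans less_add_same_cancel1 add_nonneg_pos)
    then obtain b where "b \<in> B" "ennreal (g b) < ennreal (r + e)"
      by (auto simp: INF_less_iff)
    then show "\<exists>b\<in>B. g b < r + e"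
      using assms by (auto simp: ennreal_less_iff)
  qed
next
  assume R: "\<forall>e>0. \<exists>b\<in>B. g b < r + e"
  show "(INF b\<in>B. ennreal (g b)) \<le> ennreal r"
  proof (rule ennreal_le_epsilon)
    fix e :: real assume "0 < e"
    then obtain b where "b \<in> B" "g b < r + e" using R by auto
    then have "(INF b\<in>B. ennreal (g b)) \<le> ennreal (r + e)"
      by (meson INF_lower2 ennreal_leI less_imp_le)
    then show "(INF b\<in>B. ennreal (g b)) \<le> ennreal r + ennreal e"
      using \<open>0 < e\<close> assms(2) by simp
  qed
qed

context Metric_space
begin

text \<open>The worst point of the endograph of \<open>u\<close> above \<open>x\<close> is \<open>(x, u x)\<close>: if it is near \<open>(y, s)\<close>, then a lower
  point \<open>(x, t)\<close> is at least as near to \<open>(y, min t (v y))\<close>.\<close>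

lemma endograph_excess_iff:
  assumes u: "u \<in> fuzzy_sets M" and v: "v \<in> fuzzy_sets M" and r: "0 \<le> r"
  shows "(SUP a\<in>endograph M u. INF b\<in>endograph M v. ennreal (sum_dist d a b)) \<le> ennreal r
     \<longleftrightarrow> excess_le M d u v r"
proof -
  have "(SUP a\<in>endograph M u. INF b\<in>endograph M v. ennreal (sum_dist d a b)) \<le> ennreal r
     \<longleftrightarrow> (\<forall>a\<in>endograph M u. \<forall>e>0. \<exists>b\<in>endograph M v. sum_dist d a b < r + e)"
    by (subst SUP_le_iff, subst INF_ennreal_le_iff) (auto simp: sum_dist_def r split: prod.splits)
  also have "\<dots> \<longleftrightarrow> excess_le M d u v r"
  proof
    assume L: "\<forall>a\<in>endograph M u. \<forall>e>0. \<exists>b\<in>endograph M v. sum_dist d a b < r + e"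
    show "excess_le M d u v r"
      unfolding excess_le_def
    proof (intro ballI allI impI)
      fix x e assume x: "x \<in> M" and e: "(0::real) < e"
      have "(x, u x) \<in> endograph M u"
        using x fuzzy_setsD[OF u x] by (auto simp: endograph_def)
      then obtain y s where "(y, s) \<in> endograph M v" "sum_dist d (x, u x) (y, s) < r + e"
        using L e by fastforce
      then show "\<exists>y\<in>M. d x y + max 0 (u x - v y) < r + e"
        by (intro bexI[of _ y]) (auto simp: endograph_def sum_dist_def)
    qed
  next
    assume R: "excess_le M d u v r"
    show "\<forall>a\<in>endograph M u. \<forall>e>0. \<exists>b\<in>endograph M v. sum_dist d a b < r + e"
    proof (intro ballI allI impI)
      fix a e assume a: "a \<in> endograph M u" and e: "(0::real) < e"
      obtain x t where xt: "a = (x, t)" "x \<in> M" "0 \<le> t" "t \<le> 1" "t \<le> u x"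
        using a by (auto simp: endograph_def)
      then obtain y where y: "y \<in> M" "d x y + max 0 (u x - v y) < r + e"
        using R e by (auto simp: excess_le_def)
      have "(y, min t (v y)) \<in> endograph M v"
        using y xt fuzzy_setsD[OF v y(1)] by (auto simp: endograph_def)
      moreover have "sum_dist d a (y, min t (v y)) < r + e"
        using y xt by (auto simp: sum_dist_def)
      ultimately show "\<exists>b\<in>endograph M v. sum_dist d a b < r + e" by blast
    qed
  qed
  finally show ?thesis .
qed

lemma H_end_le_iff:
  assumes u: "u \<in> fuzzy_sets M" and v: "v \<in> fuzzy_sets M" and r: "0 \<le> r"
  shows "H_end M d u v \<le> r \<longleftrightarrow> excess_le M d u v r \<and> excess_le M d v u r"
proof -
  let ?h = "hausdorff (sum_dist d) (endograph M u) (endograph M v)"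
  have sym: "sum_dist d a b = sum_dist d b a" for a b
    by (auto simp: sum_dist_def commute abs_minus_commute split: prod.splits)
  have "?h < top"
    using hausdorff_endograph_le_1[OF Metric_space_axioms u v]
    by (metis ennreal_one_less_top le_less_trans)
  then have "H_end M d u v \<le> r \<longleftrightarrow> ?h \<le> ennreal r"
    unfolding H_end_def using r
    by (metis enn2real_leI enn2real_nonneg ennreal_enn2real ennreal_leI)
  also have "\<dots> \<longleftrightarrow> excess_le M d u v r \<and> excess_le M d v u r"
    unfolding hausdorff_def max.bounded_iff
    using endograph_excess_iff[OF u v r] endograph_excess_iff[OF v u r]
    by (simp add: sym)
  finally show ?thesis .
qed

lemma H_end_commute: "H_end M d u v = H_end M d v u"
proof -
  have sym: "sum_dist d a b = sum_dist d b a" for a b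
    by (auto simp: sum_dist_def commute abs_minus_commute split: prod.splits)
  show ?thesis
    unfolding H_end_def hausdorff_def by (subst max.commute) (simp add: sym)
qed

lemma H_end_nonneg: "0 \<le> H_end M d u v"
  by (simp add: H_end_def)

lemma excess_le_H_end:
  assumes "u \<in> fuzzy_sets M" "v \<in> fuzzy_sets M" "H_end M d u v \<le> r"
  shows "excess_le M d u v r"
  using H_end_le_iff[OF assms(1,2), of r] H_end_nonneg[of u v] assms(3) by linarith

lemma excess_le_trans:
  assumes uv: "excess_le M d u v r" and vw: "excess_le M d v w s"
  shows "excess_le M d u w (r + s)"
  unfolding excess_le_def
proof (intro ballI allI impI)
  fix x e assume x: "x \<in> M" and "(0::real) < e"
  then have e: "0 < e/2" by simp
  obtain y where y: "y \<in> M" "d x y + max 0 (u x - v y) < r + e/2"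
    using uv x e unfolding excess_le_def by blast
  obtain z where z: "z \<in> M" "d y z + max 0 (v y - w z) < s + e/2"
    using vw y e unfolding excess_le_def by blast
  have "d x z + max 0 (u x - w z) < r + s + e"
    using y z triangle[OF x y(1) z(1)] by (auto simp: max_def split: if_splits)
  with z show "\<exists>z\<in>M. d x z + max 0 (u x - w z) < r + s + e" by blast
qed

section \<open>The spaces of fuzzy sets\<close>

lemma closedin_mtopology_iff_approx:
  "closedin mtopology A \<longleftrightarrow> A \<subseteq> M \<and> (\<forall>x\<in>M. (\<forall>e>0. \<exists>y\<in>A. d x y < e) \<longrightarrow> x \<in> A)"
  unfolding closedin_metric disjnt_iff in_mball
  by (metis Diff_iff not_le not_less subset_iff)

text \<open>The \<open>0\<close>-cut is a closure, so it is closed in any case, and it is nonempty as soon as the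
  \<open>1\<close>-cut is. Nonemptiness of all cuts therefore reduces to a single point of grade \<open>1\<close>.\<close>

lemma F_USC_iff:
  "u \<in> F_USC M d \<longleftrightarrow> u \<in> fuzzy_sets M \<and> (\<exists>x\<in>M. u x = 1) \<and>
     (\<forall>\<alpha>\<in>{0<..1}. closedin mtopology {x \<in> M. \<alpha> \<le> u x})" (is "?L \<longleftrightarrow> ?R")
proof
  assume ?L
  then have u: "u \<in> fuzzy_sets M"
    and c: "\<And>\<alpha>. \<alpha> \<in> {0..1} \<Longrightarrow> cut M d u \<alpha> \<in> nonempty_closed M d"
    by (auto simp: F_USC_def)
  have "\<exists>x\<in>M. 1 \<le> u x"
    using c[of 1] by (auto simp: cut_def nonempty_closed_def)
  moreover have "closedin mtopology {x \<in> M. \<alpha> \<le> u x}" if "\<alpha> \<in> {0<..1}" for \<alpha>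
    using c[of \<alpha>] that by (auto simp: cut_def nonempty_closed_def)
  ultimately show ?R
    using u fuzzy_setsD[OF u] by (metis order.antisym)
next
  assume R: ?R
  then obtain x where x: "x \<in> M" "u x = 1" by auto
  have "cut M d u \<alpha> \<in> nonempty_closed M d" if \<alpha>: "\<alpha> \<in> {0..1}" for \<alpha>
  proof (cases "\<alpha> = 0")
    case True
    have "x \<in> mtopology closure_of {x \<in> M. 0 < u x}"
      using x by (intro closure_of_subset[THEN subsetD]) auto
    then show ?thesis
      using True by (auto simp: cut_def nonempty_closed_def)
  next
    case False
    then show ?thesis
      using R \<alpha> x by (auto simp: cut_def nonempty_closed_def)
  qed
  then show ?L using R by (simp add: F_USC_def)
qed

lemma F_USCG_iff:
  "u \<in> F_USCG M d \<longleftrightarrow> u \<in> fuzzy_sets M \<and> (\<exists>x\<in>M. u x = 1) \<and>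
     (\<forall>\<alpha>\<in>{0<..1}. compactin mtopology {x \<in> M. \<alpha> \<le> u x})" (is "?L \<longleftrightarrow> ?R")
proof
  assume ?L
  then show ?R
    by (auto simp: F_USCG_def F_USC_iff cut_def nonempty_compact_def)
next
  assume R: ?R
  then have "u \<in> F_USC M d"
    unfolding F_USC_iff using compactin_imp_closedin Hausdorff_space_mtopology by blast
  moreover have "cut M d u \<alpha> \<in> nonempty_compact M d" if \<alpha>: "\<alpha> \<in> {0<..1}" for \<alpha>
    using R \<alpha> by (auto simp: cut_def nonempty_compact_def)
  ultimately show ?L by (simp add: F_USCG_def)
qed

lemma F_USCB_compactin_cut:
  assumes u: "u \<in> F_USCB M d" and \<alpha>: "\<alpha> \<in> {0<..1}"
  shows "compactin mtopology {x \<in> M. \<alpha> \<le> u x}"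
proof (rule closed_compactin)
  show "compactin mtopology (mtopology closure_of {x \<in> M. 0 < u x})"
    using u by (auto simp: F_USCB_def cut_def nonempty_compact_def)
  have "{x \<in> M. \<alpha> \<le> u x} \<subseteq> {x \<in> M. 0 < u x}" using \<alpha> by auto
  then show "{x \<in> M. \<alpha> \<le> u x} \<subseteq> mtopology closure_of {x \<in> M. 0 < u x}"
    using closure_of_subset[of "{x \<in> M. 0 < u x}" mtopology] by auto
  show "closedin mtopology {x \<in> M. \<alpha> \<le> u x}"
    using u \<alpha> by (auto simp: F_USCB_def F_USC_iff)
qed

lemma finite_support_in_F_USCB:
  assumes u: "u \<in> fuzzy_sets M" and fin: "finite {x \<in> M. 0 < u x}" and 1: "\<exists>x\<in>M. u x = 1"
  shows "u \<in> F_USCB M d"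
proof -
  have cl: "closedin mtopology S" if "S \<subseteq> {x \<in> M. 0 < u x}" for S
    using that fin t1_space_mtopology finite_subset[OF that fin]
    by (auto simp: t1_space_closedin_finite)
  have "u \<in> F_USC M d"
    unfolding F_USC_iff using u 1 by (auto intro!: cl)
  moreover have "mtopology closure_of {x \<in> M. 0 < u x} = {x \<in> M. 0 < u x}"
    by (rule closure_of_closedin) (rule cl, simp)
  then have "cut M d u 0 \<in> nonempty_compact M d"
    using fin 1 by (auto simp: cut_def nonempty_compact_def intro!: finite_imp_compactin)
  ultimately show ?thesis by (simp add: F_USCB_def)
qed

text \<open>This is where upper semicontinuity enters: excess \<open>0\<close> only gives points arbitrarily close to \<open>x\<close>
  whose \<open>v\<close>-grades almost reach \<open>u x\<close>, and closedness of the cuts of \<open>v\<close> transfers this to \<open>x\<close>.\<close>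

lemma excess_le_zero_imp_le:
  assumes u: "u \<in> fuzzy_sets M" and v: "v \<in> F_USC M d" and e0: "excess_le M d u v 0" and x: "x \<in> M"
  shows "u x \<le> v x"
proof (rule dense_le)
  fix t assume t: "t < u x"
  show "t \<le> v x"
  proof (cases "t > 0")
    case True
    have "t \<le> 1" using t fuzzy_setsD[OF u x] by linarith
    have "\<exists>y\<in>{y \<in> M. t \<le> v y}. d x y < e" if "e > 0" for e
    proof -
      have "min e (u x - t) > 0" using that t by simp
      then obtain y where y: "y \<in> M" "d x y + max 0 (u x - v y) < 0 + min e (u x - t)"
        using e0 x unfolding excess_le_def by blast
      moreover have "t \<le> v y" "d x y < e"
        using y nonneg[of x y] by linarith+
      ultimately show ?thesis by auto
    qed
    then have "x \<in> {y \<in> M. t \<le> v y}"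
      using v True \<open>t \<le> 1\<close> x unfolding F_USC_iff closedin_mtopology_iff_approx by simp
    then show ?thesis by simp
  next
    case False
    then show ?thesis
      using v fuzzy_setsD[OF _ x, of v] by (auto simp: F_USC_def)
  qed
qed

lemma Metric_space_H_end: "Metric_space (F_USC M d) (H_end M d)"
proof
  fix u v w
  show "0 \<le> H_end M d u v" "H_end M d u v = H_end M d v u"
    by (simp_all add: H_end_nonneg H_end_commute)
  assume u: "u \<in> F_USC M d" and v: "v \<in> F_USC M d"
  then have fu: "u \<in> fuzzy_sets M" and fv: "v \<in> fuzzy_sets M"
    by (auto simp: F_USC_def)
  show "H_end M d u v = 0 \<longleftrightarrow> u = v"
  proof
    assume "H_end M d u v = 0"
    then have "excess_le M d u v 0" "excess_le M d v u 0"
      using H_end_le_iff[OF fu fv, of 0] by auto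
    then have "u x = v x" if "x \<in> M" for x
      using excess_le_zero_imp_le[OF fu v _ that] excess_le_zero_imp_le[OF fv u _ that] by force
    then show "u = v"
      using fu fv unfolding fuzzy_sets_def by (blast intro: PiE_ext)
  next
    assume "u = v"
    moreover have "excess_le M d v v 0"
      unfolding excess_le_def by (intro ballI allI impI, rule_tac x=x in bexI) auto
    ultimately show "H_end M d u v = 0"
      using H_end_le_iff[OF fu fv, of 0] H_end_nonneg[of u v] by auto
  qed
  assume "w \<in> F_USC M d"
  then have fw: "w \<in> fuzzy_sets M" by (auto simp: F_USC_def)
  have "excess_le M d u w (H_end M d u v + H_end M d v w)"
    by (intro excess_le_trans[of u v] excess_le_H_end fu fv fw order_refl)
  moreover have "excess_le M d w u (H_end M d w v + H_end M d v u)"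
    by (intro excess_le_trans[of w v] excess_le_H_end fu fv fw order_refl)
  ultimately show "H_end M d u w \<le> H_end M d u v + H_end M d v w"
    using H_end_le_iff[OF fu fw] H_end_nonneg[of u v] H_end_nonneg[of v w]
    by (simp add: H_end_commute add.commute)
qed

section \<open>Kuratowski limits of endographs\<close>

text \<open>The endograph of this fuzzy set is the Kuratowski lower limit of the endographs of the \<open>f n\<close>.
  The supremum is attained (\<open>end_limit_attained\<close>), and \<open>t = 0\<close> always qualifies when all grades are
  nonnegative, so it is never the supremum of an empty set.\<close>

definition end_limit :: "(nat \<Rightarrow> 'a \<Rightarrow> real) \<Rightarrow> 'a \<Rightarrow> real" where
  "end_limit f = (\<lambda>x\<in>M. Sup {t \<in> {0..1}.
      \<forall>e>0. \<forall>\<^sub>F n in sequentially. \<exists>y\<in>M. d x y < e \<and> t - e < f n y})"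

context
  fixes f :: "nat \<Rightarrow> 'a \<Rightarrow> real"
  assumes f: "\<And>n. f n \<in> fuzzy_sets M"
begin

text \<open>Negative \<open>t\<close> is allowed because lower bounds come as a grade minus an error.\<close>

lemma end_limit_upper:
  assumes x: "x \<in> M" and t: "t \<le> 1"
    and app: "\<And>e. e > 0 \<Longrightarrow> \<forall>\<^sub>F n in sequentially. \<exists>y\<in>M. d x y < e \<and> t - e < f n y"
  shows "t \<le> end_limit f x"
proof -
  let ?S = "{t \<in> {0..1}. \<forall>e>0. \<forall>\<^sub>F n in sequentially. \<exists>y\<in>M. d x y < e \<and> t - e < f n y}"
  have "max 0 t \<in> ?S"
  proof -
    have "\<exists>y\<in>M. d x y < e \<and> 0 - e < f n y" if "e > 0" for n e
      using x that fuzzy_setsD[OF f x, of n] by (intro bexI[of _ x]) auto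
    then show ?thesis using app t by (auto simp: max_def)
  qed
  moreover have "bdd_above ?S" by (rule bdd_aboveI[of _ 1]) auto
  ultimately have "max 0 t \<le> Sup ?S" by (rule cSup_upper)
  then show ?thesis using x by (simp add: end_limit_def)
qed

lemma end_limit_attained:
  assumes x: "x \<in> M" and e: "e > 0"
  shows "\<forall>\<^sub>F n in sequentially. \<exists>y\<in>M. d x y < e \<and> end_limit f x - e < f n y"
proof -
  let ?S = "{t \<in> {0..1}. \<forall>e>0. \<forall>\<^sub>F n in sequentially. \<exists>y\<in>M. d x y < e \<and> t - e < f n y}"
  have "\<exists>y\<in>M. d x y < e \<and> 0 - e < f n y" if "e > 0" for n e
    using x that fuzzy_setsD[OF f x, of n] by (intro bexI[of _ x]) auto
  then have "0 \<in> ?S" by auto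
  then have "?S \<noteq> {}" by blast
  moreover have "end_limit f x - e/2 < Sup ?S"
    using x e by (simp add: end_limit_def)
  ultimately obtain t where t: "t \<in> ?S" "end_limit f x - e/2 < t"
    using less_cSupD by meson
  then have "\<forall>\<^sub>F n in sequentially. \<exists>y\<in>M. d x y < e/2 \<and> t - e/2 < f n y"
    using half_gt_zero[OF e] by blast
  then show ?thesis
  proof eventually_elim
    case (elim n)
    then obtain y where "y \<in> M" "d x y < e/2" "t - e/2 < f n y" by auto
    then show ?case using t e by (intro bexI[of _ y]) auto
  qed
qed

lemma end_limit_fuzzy: "end_limit f \<in> fuzzy_sets M"
proof -
  have "0 \<le> end_limit f x \<and> end_limit f x \<le> 1" if x: "x \<in> M" for x
  proof
    show "0 \<le> end_limit f x"
    proof (rule end_limit_upper[OF x])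
      fix e :: real assume "e > 0"
      then have "\<exists>y\<in>M. d x y < e \<and> 0 - e < f n y" for n
        using x fuzzy_setsD[OF f x, of n] by (intro bexI[of _ x]) auto
      then show "\<forall>\<^sub>F n in sequentially. \<exists>y\<in>M. d x y < e \<and> 0 - e < f n y" by simp
    qed simp
    show "end_limit f x \<le> 1"
    proof (rule field_le_epsilon)
      fix e :: real assume "0 < e"
      from eventually_happens[OF end_limit_attained[OF x this]]
      obtain n y where "y \<in> M" "end_limit f x - e < f n y" by auto
      then show "end_limit f x \<le> 1 + e" using fuzzy_setsD[OF f, of y n] by auto
    qed
  qed
  moreover have "end_limit f \<in> extensional M" by (simp add: end_limit_def)
  ultimately show ?thesis by (simp add: fuzzy_sets_def PiE_iff)
qed

text \<open>A lower limit of sets is closed, even if those sets are not.\<close>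

lemma end_limit_closedin_cut:
  assumes "\<alpha> \<le> 1"
  shows "closedin mtopology {x \<in> M. \<alpha> \<le> end_limit f x}"
  unfolding closedin_mtopology_iff_approx
proof (intro conjI ballI impI)
  fix x assume x: "x \<in> M" and app: "\<forall>e>0. \<exists>y\<in>{x \<in> M. \<alpha> \<le> end_limit f x}. d x y < e"
  have "\<alpha> \<le> end_limit f x"
  proof (rule end_limit_upper[OF x assms])
    fix e :: real assume "e > 0"
    then have e: "e/2 > 0" by simp
    then obtain y where y: "y \<in> M" "\<alpha> \<le> end_limit f y" "d x y < e/2" using app by blast
    from end_limit_attained[OF y(1) e]
    show "\<forall>\<^sub>F n in sequentially. \<exists>z\<in>M. d x z < e \<and> \<alpha> - e < f n z"
    proof eventually_elim
      case (elim n)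
      then obtain z where "z \<in> M" "d y z < e/2" "end_limit f y - e/2 < f n z" by auto
      then show ?case using y e triangle[OF x y(1), of z] by (intro bexI[of _ z]) auto
    qed
  qed
  then show "x \<in> {x \<in> M. \<alpha> \<le> end_limit f x}" using x by simp
qed auto

text \<open>A grade of the limit at \<open>x\<close> is nearly reached close to \<open>x\<close> by some late \<open>f m\<close>, so a bound valid for
  all late \<open>f m\<close> passes to the limit.\<close>

lemma excess_le_end_limit_left:
  assumes N: "\<And>m. m \<ge> N \<Longrightarrow> excess_le M d (f m) v r"
  shows "excess_le M d (end_limit f) v r"
  unfolding excess_le_def
proof (intro ballI allI impI)
  fix x e assume x: "x \<in> M" and "(0::real) < e"
  then have e: "0 < e/3" by simp
  from eventually_happens[OF eventually_conj[OF eventually_ge_at_top[of N] end_limit_attained[OF x e]]]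
  obtain m y where "m \<ge> N" and y: "y \<in> M" "d x y < e/3" "end_limit f x - e/3 < f m y" by auto
  obtain z where z: "z \<in> M" "d y z + max 0 (f m y - v z) < r + e/3"
    using N[OF \<open>m \<ge> N\<close>] y(1) e unfolding excess_le_def by blast
  have "d x z + max 0 (end_limit f x - v z) < r + e"
    using y z triangle[OF x y(1) z(1)] e by (auto simp: max_def split: if_splits)
  then show "\<exists>z\<in>M. d x z + max 0 (end_limit f x - v z) < r + e" using z by blast
qed

end

lemma geometric_steps_converge:
  assumes "mcomplete" and xM: "\<And>k. x k \<in> M" and step: "\<And>k. d (x k) (x (Suc k)) < r / 2 ^ k"
  obtains y where "y \<in> M" "\<And>k. d (x k) y \<le> 2 * r / 2 ^ k"
proof -
  have "d (x 0) (x (Suc 0)) < r" using step[of 0] by simp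
  then have r: "r > 0" using nonneg[of "x 0" "x (Suc 0)"] by linarith
  have part: "d (x k) (x (k + j)) \<le> 2 * r / 2 ^ k - 2 * r / 2 ^ (k + j)" for k j
  proof (induction j)
    case 0
    then show ?case using xM by simp
  next
    case (Suc j)
    have "d (x k) (x (k + Suc j)) \<le> d (x k) (x (k + j)) + d (x (k + j)) (x (Suc (k + j)))"
      using triangle[OF xM xM xM] by simp
    also have "\<dots> \<le> 2 * r / 2 ^ k - 2 * r / 2 ^ (k + j) + r / 2 ^ (k + j)"
      using Suc step[of "k + j"] by linarith
    also have "\<dots> = 2 * r / 2 ^ k - 2 * r / 2 ^ (k + Suc j)" by (simp add: field_simps)
    finally show ?case .
  qed
  have tail: "d (x k) (x m) \<le> 2 * r / 2 ^ k" if "k \<le> m" for k m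
  proof -
    from le_Suc_ex[OF that] obtain j where j: "m = k + j" by blast
    have "0 \<le> 2 * r / 2 ^ (k + j)" using r by simp
    then show ?thesis unfolding j using part[of k j] by linarith
  qed
  have small: "\<exists>k. 2 * r / 2 ^ k < e" if "e > 0" for e
  proof -
    have "(\<lambda>k. (2 * r) * (1/2) ^ k) \<longlonglongrightarrow> (2 * r) * 0"
      by (intro tendsto_mult tendsto_const LIMSEQ_power_zero) simp
    then have "\<forall>\<^sub>F k in sequentially. (2 * r) * (1/2) ^ k < e"
      using that by (auto dest: order_tendstoD)
    then show ?thesis by (auto simp: eventually_sequentially power_divide)
  qed
  have "MCauchy x"
    unfolding MCauchy_def
  proof (intro conjI allI impI)
    show "range x \<subseteq> M" using xM by auto
    fix e :: real assume "e > 0"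
    then obtain k where k: "2 * r / 2 ^ k < e/2" using small[of "e/2"] by auto
    have "d (x n) (x n') < e" if "k \<le> n" "k \<le> n'" for n n'
      using triangle''[OF xM xM xM, of n n' k] tail[OF that(1)] tail[OF that(2)] k by linarith
    then show "\<exists>k. \<forall>n n'. k \<le> n \<longrightarrow> k \<le> n' \<longrightarrow> d (x n) (x n') < e" by blast
  qed
  then obtain y where y: "limitin mtopology x y sequentially"
    using assms(1) by (auto simp: mcomplete_def)
  then have yM: "y \<in> M" using limitin_mspace by blast
  have "d (x k) y \<le> 2 * r / 2 ^ k" for k
  proof (rule field_le_epsilon)
    fix e :: real assume "0 < e"
    then obtain N where N: "\<And>n. n \<ge> N \<Longrightarrow> d (x n) y < e"
      using y unfolding limit_metric_sequentially by blast
    show "d (x k) y \<le> 2 * r / 2 ^ k + e"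
      using triangle[OF xM[of k] xM[of "max k N"] yM] tail[of k "max k N"] N[of "max k N"] by simp
  qed
  with yM show thesis using that by blast
qed

text \<open>Start at \<open>x\<close> with its grade in \<open>f n\<close> and pass along a subsequence \<open>\<nu>\<close>, choosing at stage \<open>k\<close> a point
  that costs less than \<open>r / 2 ^ k\<close>, in distance and lost grade together. The points converge within
  distance \<open>2 * r\<close>, and at most \<open>2 * r\<close> of the grade is lost. At stage \<open>k\<close> every later member of \<open>f\<close>,
  in the subsequence or not, comes as close as the next one, so the end point has the
  remaining grade in the lower limit.\<close>

lemma excess_le_end_limit_right:
  assumes "mcomplete" and f: "\<And>n. f n \<in> fuzzy_sets M"
    and N: "\<And>k m m'. N k \<le> m \<Longrightarrow> N k \<le> m' \<Longrightarrow> excess_le M d (f m) (f m') (r / 2 ^ Suc k)"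
    and r: "r > 0" and n: "N 0 \<le> n"
  shows "excess_le M d (f n) (end_limit f) (4 * r)"
  unfolding excess_le_def
proof (intro ballI allI impI)
  fix x e assume x: "x \<in> M" and "(0::real) < e"
  \<comment> \<open>The sum makes \<open>\<nu>\<close> monotone and lets \<open>\<nu> k\<close> dominate \<open>N k\<close>, while \<open>\<nu>\<close> starts exactly at \<open>n\<close>.\<close>
  define \<nu> where "\<nu> k = n + (\<Sum>i<k. N (Suc i))" for k
  have \<nu>0: "\<nu> 0 = n" by (simp add: \<nu>_def)
  have \<nu>_Suc: "\<nu> k \<le> \<nu> (Suc k)" for k by (simp add: \<nu>_def)
  have \<nu>N: "N k \<le> \<nu> k" for k
    using n by (cases k) (simp_all add: \<nu>_def)
  have near: "\<exists>z\<in>M. d y z + max 0 (f (\<nu> k) y - f m z) < r / 2 ^ k"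
    if "y \<in> M" "\<nu> k \<le> m" for y k m
  proof -
    have "excess_le M d (f (\<nu> k)) (f m) (r / 2 ^ Suc k)"
      using N[of k] \<nu>N[of k] that(2) by simp
    moreover have "r / 2 ^ Suc k > 0" using r by simp
    ultimately have "\<exists>z\<in>M. d y z + max 0 (f (\<nu> k) y - f m z) < r / 2 ^ Suc k + r / 2 ^ Suc k"
      using that(1) unfolding excess_le_def by blast
    then show ?thesis by (simp add: field_simps)
  qed
  obtain y where y0: "y 0 = x" and yM: "\<And>k. y k \<in> M"
    and y: "\<And>k. d (y k) (y (Suc k)) + max 0 (f (\<nu> k) (y k) - f (\<nu> (Suc k)) (y (Suc k))) < r / 2 ^ k"
  proof -
    have "\<exists>y. \<forall>k. (y k \<in> M \<and> (k = 0 \<longrightarrow> y k = x)) \<and>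
      (d (y k) (y (Suc k)) + max 0 (f (\<nu> k) (y k) - f (\<nu> (Suc k)) (y (Suc k))) < r / 2 ^ k)"
      by (rule dependent_nat_choice[where P = "\<lambda>k y. y \<in> M \<and> (k = 0 \<longrightarrow> y = x)"
            and Q = "\<lambda>k y y'. d y y' + max 0 (f (\<nu> k) y - f (\<nu> (Suc k)) y') < r / 2 ^ k"])
        (use x near[OF _ \<nu>_Suc] in blast)+
    then show thesis using that by blast
  qed
  have "d (y k) (y (Suc k)) < r / 2 ^ k" for k using y[of k] by linarith
  then obtain z where z: "z \<in> M" "\<And>k. d (y k) z \<le> 2 * r / 2 ^ k"
    using geometric_steps_converge[of y r, OF assms(1) yM] by blast
  \<comment> \<open>The term \<open>2 * r / 2 ^ k\<close> is the sum of all losses from stage \<open>k\<close> on.\<close>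
  have grade: "f n x - 2 * r + 2 * r / 2 ^ k \<le> f (\<nu> k) (y k)" for k
  proof (induction k)
    case 0
    then show ?case by (simp add: y0 \<nu>0)
  next
    case (Suc k)
    have "f (\<nu> k) (y k) - f (\<nu> (Suc k)) (y (Suc k)) < r / 2 ^ k"
      using y[of k] nonneg[of "y k" "y (Suc k)"] by linarith
    moreover have "2 * r / 2 ^ Suc k = r / 2 ^ k" "2 * r / 2 ^ k = r / 2 ^ k + r / 2 ^ k"
      by (simp_all add: field_simps)
    ultimately show ?case using Suc by linarith
  qed
  have "f n x - 2 * r \<le> end_limit f z"
  proof (rule end_limit_upper[OF f z(1)])
    show "f n x - 2 * r \<le> 1" using fuzzy_setsD[OF f x, of n] r by linarith
    fix \<epsilon> :: real assume \<epsilon>: "\<epsilon> > 0"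
    have "(\<lambda>k. (3 * r) * (1/2) ^ k) \<longlonglongrightarrow> (3 * r) * 0"
      by (intro tendsto_mult tendsto_const LIMSEQ_power_zero) simp
    then have "\<forall>\<^sub>F k in sequentially. (3 * r) * (1/2) ^ k < \<epsilon>"
      using \<epsilon> by (auto dest: order_tendstoD)
    then obtain k where "3 * r / 2 ^ k < \<epsilon>"
      by (auto simp: eventually_sequentially power_divide)
    then have k: "2 * r / 2 ^ k + r / 2 ^ k < \<epsilon>" by (simp add: field_simps)
    have pos: "0 < r / 2 ^ k" "0 < 2 * r / 2 ^ k" using r by simp_all
    have "\<exists>w\<in>M. d z w < \<epsilon> \<and> f n x - 2 * r - \<epsilon> < f m w" if "\<nu> k \<le> m" for m
    proof -
      obtain w where w: "w \<in> M" "d (y k) w + max 0 (f (\<nu> k) (y k) - f m w) < r / 2 ^ k"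
        using near[OF yM \<open>\<nu> k \<le> m\<close>] by blast
      have "d z w < \<epsilon>"
        using triangle''[OF z(1) yM w(1), of k] z(2)[of k] w(2) k by linarith
      moreover have "f n x - 2 * r - \<epsilon> < f m w"
        using grade[of k] w(2) nonneg[of "y k" w] k pos by linarith
      ultimately show ?thesis using w(1) by blast
    qed
    then show "\<forall>\<^sub>F m in sequentially. \<exists>w\<in>M. d z w < \<epsilon> \<and> f n x - 2 * r - \<epsilon> < f m w"
      unfolding eventually_sequentially by blast
  qed
  moreover have "d x z \<le> 2 * r" using z(2)[of 0] y0 by simp
  ultimately have "d x z + max 0 (f n x - end_limit f z) < 4 * r + e"
    using \<open>0 < e\<close> r by (auto simp: max_def)
  with z(1) show "\<exists>z\<in>M. d x z + max 0 (f n x - end_limit f z) < 4 * r + e" by blast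
qed

section \<open>Completeness\<close>

text \<open>A net of a nearby totally bounded set need not lie in \<open>S\<close>; replacing each of its points by a
  nearby point of \<open>S\<close>, where there is one, costs only a constant factor.\<close>

lemma mtotally_bounded_if_near:
  assumes SM: "S \<subseteq> M"
    and near: "\<And>e. e > 0 \<Longrightarrow> \<exists>T. mtotally_bounded T \<and> (\<forall>x\<in>S. \<exists>y\<in>T. d x y < e)"
  shows "mtotally_bounded S"
  unfolding mtotally_bounded_def
proof (intro allI impI)
  fix e :: real assume "e > 0"
  then have e: "e/4 > 0" by simp
  then obtain T where T: "mtotally_bounded T" "\<forall>x\<in>S. \<exists>y\<in>T. d x y < e/4" using near by blast
  then obtain K where K: "finite K" "K \<subseteq> T" "T \<subseteq> (\<Union>x\<in>K. mball x (e/4))"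
    using e unfolding mtotally_bounded_def by meson
  have TM: "T \<subseteq> M" using T mtotally_bounded_imp_subset by blast
  define P where "P = {p \<in> K. \<exists>s\<in>S. d p s < e/2}"
  then have "\<forall>p\<in>P. \<exists>s\<in>S. d p s < e/2" by blast
  then obtain g where g: "\<And>p. p \<in> P \<Longrightarrow> g p \<in> S \<and> d p (g p) < e/2" by metis
  have "x \<in> (\<Union>p\<in>g ` P. mball p e)" if x: "x \<in> S" for x
  proof -
    obtain y where y: "y \<in> T" "d x y < e/4" using T x by blast
    then obtain p where p: "p \<in> K" "d p y < e/4" using K by auto
    have M: "x \<in> M" "y \<in> M" "p \<in> M" using x y p SM TM K by auto
    have px: "d p x < e/2" using triangle'[of p y x] M y p by linarith
    then have "p \<in> P" using p x by (auto simp: P_def)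
    moreover have "d (g p) x < e"
      using g[OF \<open>p \<in> P\<close>] px M SM triangle''[of "g p" p x] by force
    ultimately show ?thesis using g M SM by auto
  qed
  then show "\<exists>K. finite K \<and> K \<subseteq> S \<and> S \<subseteq> (\<Union>x\<in>K. mball x e)"
    using K(1) g by (intro exI[of _ "g ` P"]) (auto simp: P_def)
qed

text \<open>If the excess \<open>r\<close> is small compared with \<open>\<alpha>\<close>, then each point of the \<open>\<alpha>\<close>-cut of \<open>u\<close> lies near a point
  of the \<open>\<alpha>/2\<close>-cut of \<open>v\<close>, which is totally bounded.\<close>

lemma compact_cut_if_excess_le:
  assumes "mcomplete" and \<alpha>: "0 < \<alpha>" "\<alpha> \<le> 1"
    and closed: "closedin mtopology {x \<in> M. \<alpha> \<le> u x}"
    and app: "\<And>r. r > 0 \<Longrightarrow> \<exists>v\<in>F_USCG M d. excess_le M d u v r"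
  shows "compactin mtopology {x \<in> M. \<alpha> \<le> u x}"
proof -
  have "mtotally_bounded {x \<in> M. \<alpha> \<le> u x}"
  proof (rule mtotally_bounded_if_near)
    fix e :: real assume "e > 0"
    then have r: "min e \<alpha> / 4 > 0" using \<alpha> by simp
    then obtain v where v: "v \<in> F_USCG M d" "excess_le M d u v (min e \<alpha> / 4)" using app by blast
    have "\<alpha>/2 \<in> {0<..1}" using \<alpha> by simp
    with v(1) have "compactin mtopology {y \<in> M. \<alpha>/2 \<le> v y}" unfolding F_USCG_iff by blast
    then have "mtotally_bounded {y \<in> M. \<alpha>/2 \<le> v y}" by (rule compactin_imp_mtotally_bounded)
    moreover have "\<exists>y\<in>{y \<in> M. \<alpha>/2 \<le> v y}. d x y < e" if x: "x \<in> {x \<in> M. \<alpha> \<le> u x}" for x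
    proof -
      obtain y where y: "y \<in> M" "d x y + max 0 (u x - v y) < min e \<alpha> / 4 + min e \<alpha> / 4"
        using v(2) x r unfolding excess_le_def by blast
      have "min e \<alpha> \<le> e" "min e \<alpha> \<le> \<alpha>" by simp_all
      then have "d x y < e" "\<alpha>/2 \<le> v y"
        using y(2) x nonneg[of x y] r unfolding mem_Collect_eq by linarith+
      with y show ?thesis by blast
    qed
    ultimately show "\<exists>T. mtotally_bounded T \<and> (\<forall>x\<in>{x \<in> M. \<alpha> \<le> u x}. \<exists>y\<in>T. d x y < e)" by blast
  qed auto
  then show ?thesis
    using mtotally_bounded_eq_compact_closure_of[OF assms(1)] closure_of_closedin[OF closed] by metis
qed

text \<open>Upper semicontinuity alone does not let \<open>u\<close> attain its supremum; a maximising sequence stays in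
  the \<open>1/2\<close>-cut, and compactness of that cut provides the maximiser.\<close>

lemma F_USCG_memI_sup:
  assumes u: "u \<in> fuzzy_sets M"
    and cpt: "\<And>\<alpha>. 0 < \<alpha> \<Longrightarrow> \<alpha> \<le> 1 \<Longrightarrow> compactin mtopology {x \<in> M. \<alpha> \<le> u x}"
    and sup: "\<And>e. e > 0 \<Longrightarrow> \<exists>x\<in>M. 1 - e \<le> u x"
  shows "u \<in> F_USCG M d"
proof -
  have "\<forall>k. \<exists>x\<in>M. 1 - 1 / real (k + 2) \<le> u x" using sup by simp
  then obtain x where x: "\<And>k. x k \<in> M" "\<And>k. 1 - 1 / real (k + 2) \<le> u (x k)" by metis
  have "1/2 \<le> u (x k)" for k
  proof -
    have "1 / real (k + 2) \<le> 1 / 2" by (intro divide_left_mono) auto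
    then show ?thesis using x(2)[of k] by linarith
  qed
  then have "range x \<subseteq> {x \<in> M. 1/2 \<le> u x}" using x(1) by auto
  moreover have "compactin mtopology {x \<in> M. 1/2 \<le> u x}" by (rule cpt) simp_all
  ultimately have "\<exists>l s. l \<in> {x \<in> M. 1/2 \<le> u x} \<and> strict_mono s \<and>
      limitin mtopology (x \<circ> s) l sequentially"
    unfolding compactin_sequentially by simp
  then obtain l and s :: "nat \<Rightarrow> nat" where l: "l \<in> M" and s: "strict_mono s"
    and lim: "limitin mtopology (x \<circ> s) l sequentially" by blast
  have "1 \<le> u l"
  proof (rule dense_le)
    fix t :: real assume t: "t < 1"
    show "t \<le> u l"
    proof (cases "t > 0")
      case True
      have "l \<in> {x \<in> M. t \<le> u x}"
      proof (rule limitin_closedin[OF lim])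
        show "closedin mtopology {x \<in> M. t \<le> u x}"
          using cpt[of t] t True compactin_imp_closedin Hausdorff_space_mtopology by auto
        obtain k where k: "1 / real (Suc k) < 1 - t"
          using reals_Archimedean[of "1 - t"] t by (auto simp: inverse_eq_divide)
        have "(x \<circ> s) n \<in> {x \<in> M. t \<le> u x}" if "k \<le> n" for n
        proof -
          have "k \<le> s n" using that seq_suble[OF s, of n] by linarith
          then have "1 / real (s n + 2) \<le> 1 / real (Suc k)" by (intro divide_left_mono) auto
          then show ?thesis using x(1)[of "s n"] x(2)[of "s n"] k by simp
        qed
        then show "\<forall>\<^sub>F n in sequentially. (x \<circ> s) n \<in> {x \<in> M. t \<le> u x}"
          unfolding eventually_sequentially by blast
      qed simp
      then show ?thesis by simp
    next
      case False
      then show ?thesis using fuzzy_setsD[OF u l] by linarith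
    qed
  qed
  then have "u l = 1" using fuzzy_setsD[OF u l] by linarith
  then show ?thesis using u l cpt unfolding F_USCG_iff by auto
qed

lemma F_USCG_subset: "F_USCG M d \<subseteq> F_USC M d"
  by (auto simp: F_USCG_def)

lemma Metric_space_F_USCG: "Metric_space (F_USCG M d) (H_end M d)"
  by (rule Metric_space.subspace[OF Metric_space_H_end F_USCG_subset])

lemma mcomplete_F_USCG:
  assumes mc: "mcomplete"
  shows "Metric_space.mcomplete (F_USCG M d) (H_end M d)"
proof -
  interpret G: Metric_space "F_USCG M d" "H_end M d" by (rule Metric_space_F_USCG)
  have "\<exists>u. limitin G.mtopology f u sequentially" if C: "G.MCauchy f" for f
  proof -
    have fG: "f n \<in> F_USCG M d" for n using C by (auto simp: G.MCauchy_def)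
    then have f: "f n \<in> fuzzy_sets M" for n unfolding F_USCG_iff by blast
    have ex: "\<exists>N. \<forall>m\<ge>N. \<forall>m'\<ge>N. excess_le M d (f m) (f m') r" if "r > 0" for r
    proof -
      obtain N where "\<And>m m'. N \<le> m \<Longrightarrow> N \<le> m' \<Longrightarrow> H_end M d (f m) (f m') < r"
        using C \<open>r > 0\<close> unfolding G.MCauchy_def by blast
      then show ?thesis by (meson excess_le_H_end f less_imp_le)
    qed
    let ?u = "end_limit f"
    have u: "?u \<in> fuzzy_sets M" by (rule end_limit_fuzzy[OF f])
    have conv: "\<exists>K. \<forall>n\<ge>K. excess_le M d ?u (f n) r \<and> excess_le M d (f n) ?u r" if r: "r > 0" for r
    proof -
      obtain K where K: "\<forall>m\<ge>K. \<forall>m'\<ge>K. excess_le M d (f m) (f m') r" using ex[OF r] by blast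
      have "\<forall>k. \<exists>N. \<forall>m\<ge>N. \<forall>m'\<ge>N. excess_le M d (f m) (f m') (r / 4 / 2 ^ Suc k)"
        using r by (intro allI ex) simp
      then obtain N where N: "\<And>k. \<forall>m\<ge>N k. \<forall>m'\<ge>N k. excess_le M d (f m) (f m') (r / 4 / 2 ^ Suc k)"
        by metis
      have "excess_le M d ?u (f n) r \<and> excess_le M d (f n) ?u r" if n: "n \<ge> max K (N 0)" for n
      proof
        show "excess_le M d ?u (f n) r"
          using K n by (intro excess_le_end_limit_left[OF f, of K]) auto
        have "excess_le M d (f n) ?u (4 * (r / 4))"
          using N n r by (intro excess_le_end_limit_right[OF mc f, of N]) auto
        then show "excess_le M d (f n) ?u r" by simp
      qed
      then show ?thesis by blast
    qed
    have uG: "?u \<in> F_USCG M d"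
    proof (rule F_USCG_memI_sup[OF u])
      fix \<alpha> :: real assume \<alpha>: "0 < \<alpha>" "\<alpha> \<le> 1"
      show "compactin mtopology {x \<in> M. \<alpha> \<le> ?u x}"
        by (rule compact_cut_if_excess_le[OF mc \<alpha> end_limit_closedin_cut[OF f \<alpha>(2)]])
          (use conv fG in blast)
    next
      fix e :: real assume "e > 0"
      then have e: "e/2 > 0" by simp
      obtain n where n: "excess_le M d (f n) ?u (e/2)" using conv[OF e] by blast
      obtain x where x: "x \<in> M" "f n x = 1" using fG[of n] unfolding F_USCG_iff by blast
      obtain y where y: "y \<in> M" "d x y + max 0 (f n x - ?u y) < e/2 + e/2"
        using n x e unfolding excess_le_def by blast
      have "1 - e \<le> ?u y" using y(2) x(2) nonneg[of x y] by linarith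
      then show "\<exists>x\<in>M. 1 - e \<le> ?u x" using y(1) by blast
    qed
    have "limitin G.mtopology f ?u sequentially"
      unfolding G.limit_metric_sequentially
    proof (intro conjI allI impI uG)
      fix e :: real assume "e > 0"
      then have e: "e/2 > 0" by simp
      obtain K where K: "\<forall>n\<ge>K. excess_le M d ?u (f n) (e/2) \<and> excess_le M d (f n) ?u (e/2)"
        using conv[OF e] by blast
      have "H_end M d (f n) ?u < e" if "n \<ge> K" for n
        using H_end_le_iff[OF f u, of "e/2" n] K that e by auto
      then show "\<exists>K. \<forall>n\<ge>K. f n \<in> F_USCG M d \<and> H_end M d (f n) ?u < e" using fG by blast
    qed
    then show ?thesis by blast
  qed
  then show ?thesis by (simp add: G.mcomplete_def)
qed

end

section \<open>Embedding and density\<close>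

lemma zero_extend_fuzzy:
  assumes "u \<in> fuzzy_sets X"
  shows "zero_extend X Z u \<in> fuzzy_sets Z"
  using fuzzy_setsD[OF assms] by (auto simp: fuzzy_sets_def zero_extend_def)

context Submetric
begin

text \<open>The extra points of the big space have grade \<open>0\<close>. They are reached for free, and going to
  one of them is never better than staying at \<open>x\<close> and giving up the grade there.\<close>

lemma excess_le_zero_extend_iff:
  assumes u: "u \<in> fuzzy_sets A" and v: "v \<in> fuzzy_sets A" and r: "0 \<le> r"
  shows "excess_le M d (zero_extend A M u) (zero_extend A M v) r \<longleftrightarrow> excess_le A d u v r"
proof
  assume L: "excess_le M d (zero_extend A M u) (zero_extend A M v) r"
  show "excess_le A d u v r"
    unfolding excess_le_def
  proof (intro ballI allI impI)
    fix x e assume x: "x \<in> A" and e: "(0::real) < e"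
    with subset have xM: "x \<in> M" by blast
    then obtain y where y: "y \<in> M"
      "d x y + max 0 (zero_extend A M u x - zero_extend A M v y) < r + e"
      using L e unfolding excess_le_def by blast
    show "\<exists>y\<in>A. d x y + max 0 (u x - v y) < r + e"
    proof (cases "y \<in> A")
      case True
      then show ?thesis using x xM y by (auto simp: zero_extend_def)
    next
      case False
      then have "u x < r + e"
        using x xM y(1) le_less_trans[OF le_add_same_cancel2[THEN iffD2, OF nonneg] y(2)]
        by (simp add: zero_extend_def)
      then have "d x x + max 0 (u x - v x) < r + e"
        using fuzzy_setsD[OF v x] xM r e by auto
      then show ?thesis using x by blast
    qed
  qed
next
  assume R: "excess_le A d u v r"
  show "excess_le M d (zero_extend A M u) (zero_extend A M v) r"
    unfolding excess_le_def
  proof (intro ballI allI impI)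
    fix x e assume x: "x \<in> M" and e: "(0::real) < e"
    show "\<exists>y\<in>M. d x y + max 0 (zero_extend A M u x - zero_extend A M v y) < r + e"
    proof (cases "x \<in> A")
      case True
      then obtain y where "y \<in> A" "d x y + max 0 (u x - v y) < r + e"
        using R e unfolding excess_le_def by blast
      then show ?thesis using x True subset by (intro bexI[of _ y]) (auto simp: zero_extend_def)
    next
      case False
      then show ?thesis using x e r by (intro bexI[of _ x]) (auto simp: zero_extend_def)
    qed
  qed
qed

lemma H_end_zero_extend:
  assumes u: "u \<in> fuzzy_sets A" and v: "v \<in> fuzzy_sets A"
  shows "H_end M d (zero_extend A M u) (zero_extend A M v) = H_end A d u v"
proof -
  have "H_end M d (zero_extend A M u) (zero_extend A M v) \<le> r \<longleftrightarrow> H_end A d u v \<le> r" if "0 \<le> r" for r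
    using that u v
    by (simp add: H_end_le_iff sub.H_end_le_iff zero_extend_fuzzy excess_le_zero_extend_iff)
  then show ?thesis
    by (meson H_end_nonneg sub.H_end_nonneg order.antisym order_refl)
qed

text \<open>For positive levels the extension has the same cuts, and compactness of a set does not depend
  on the ambient space. For merely closed cuts this would fail, as \<open>A\<close> need not be closed.\<close>

lemma zero_extend_in_F_USCG:
  assumes u: "u \<in> F_USCB A d"
  shows "zero_extend A M u \<in> F_USCG M d"
  unfolding F_USCG_iff
proof (intro conjI ballI)
  have "u \<in> F_USC A d" using u by (simp add: F_USCB_def)
  then have fu: "u \<in> fuzzy_sets A" and "\<exists>x\<in>A. u x = 1" unfolding sub.F_USC_iff by auto
  then show "zero_extend A M u \<in> fuzzy_sets M" "\<exists>x\<in>M. zero_extend A M u x = 1"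
    using zero_extend_fuzzy subset by (auto simp: zero_extend_def)
  fix \<alpha> :: real assume \<alpha>: "\<alpha> \<in> {0<..1}"
  have "{x \<in> M. \<alpha> \<le> zero_extend A M u x} = {x \<in> A. \<alpha> \<le> u x}"
    using \<alpha> subset by (auto simp: zero_extend_def)
  then show "compactin mtopology {x \<in> M. \<alpha> \<le> zero_extend A M u x}"
    using sub.F_USCB_compactin_cut[OF u \<alpha>] by (simp add: mtopology_submetric compactin_subtopology)
qed

text \<open>Taking suprema over \<open>e\<close>-balls, rather than values of \<open>u\<close> at the points of the net, is what keeps
  the grades from dropping: \<open>u\<close> is only upper semicontinuous, and the points of the net lie in the
  subspace, where \<open>u\<close> may vanish altogether.\<close>

lemma finite_support_approximation:
  assumes dense: "mtopology closure_of A = M" and u: "u \<in> F_USCG M d" and e: "0 < e" "e \<le> 1"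
  shows "\<exists>v\<in>F_USCB A d. H_end M d (zero_extend A M v) u \<le> 2 * e"
proof -
  have fu: "u \<in> fuzzy_sets M" and cpt: "compactin mtopology {x \<in> M. e \<le> u x}"
    using u e unfolding F_USCG_iff by auto
  \<comment> \<open>A net point close to \<open>x1\<close> will have grade \<open>1\<close>.\<close>
  obtain x1 where x1: "x1 \<in> M" "u x1 = 1" using u unfolding F_USCG_iff by blast
  have "e/2 > 0" using e by simp
  then obtain K where K: "finite K" "K \<subseteq> {x \<in> M. e \<le> u x}"
    "{x \<in> M. e \<le> u x} \<subseteq> (\<Union>x\<in>K. mball x (e/2))"
    using compactin_imp_mtotally_bounded[OF cpt] unfolding mtotally_bounded_def by meson
  have "\<forall>x\<in>K. \<exists>y\<in>A. d x y < e/2"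
  proof
    fix x assume "x \<in> K"
    then have "x \<in> mtopology closure_of A" using dense K by auto
    then show "\<exists>y\<in>A. d x y < e/2" using \<open>e/2 > 0\<close> unfolding metric_closure_of in_mball by blast
  qed
  then obtain g where g: "\<And>x. x \<in> K \<Longrightarrow> g x \<in> A \<and> d x (g x) < e/2" by metis
  define S where "S = g ` K"
  have SA: "S \<subseteq> A" and finS: "finite S" using g K by (auto simp: S_def)
  have net: "\<exists>y\<in>S. d x y < e" if x: "x \<in> M" "e \<le> u x" for x
  proof -
    obtain p where p: "p \<in> K" "d p x < e/2" "p \<in> M" using K x by force
    then have "d x (g p) < e"
      using g[OF p(1)] triangle''[of x p "g p"] x subset by fastforce
    then show ?thesis using p by (auto simp: S_def)
  qed
  define V where "V y = {u z |z. z \<in> M \<and> d z y < e}" for y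
  have bdd: "bdd_above (V y)" for y
    using fuzzy_setsD[OF fu] by (intro bdd_aboveI[of _ 1]) (auto simp: V_def)
  have V_ge: "u z \<le> Sup (V y)" if "z \<in> M" "d z y < e" for z y
    using that by (intro cSup_upper bdd) (auto simp: V_def)
  have V_ne: "u y \<in> V y" if "y \<in> M" for y using that e by (auto simp: V_def)
  have V_range: "0 \<le> Sup (V y) \<and> Sup (V y) \<le> 1" if y: "y \<in> M" for y
  proof
    show "Sup (V y) \<le> 1"
      using V_ne[OF y] fuzzy_setsD[OF fu] by (intro cSup_least) (auto simp: V_def)
    show "0 \<le> Sup (V y)" using V_ge[of y y] y e fuzzy_setsD[OF fu y] by auto
  qed
  define v where "v = (\<lambda>y\<in>A. if y \<in> S then Sup (V y) else 0)"
  have fv: "v \<in> fuzzy_sets A"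
    using V_range subset by (auto simp: v_def fuzzy_sets_def)
  have "v \<in> F_USCB A d"
  proof (rule sub.finite_support_in_F_USCB[OF fv])
    show "finite {x \<in> A. 0 < v x}"
      by (rule finite_subset[OF _ finS]) (auto simp: v_def split: if_splits)
    obtain y where y: "y \<in> S" "d x1 y < e" using net[OF x1(1)] x1 e by auto
    then have "v y = 1"
      using V_ge[OF x1(1) y(2)] V_range[of y] SA subset x1 by (auto simp: v_def)
    then show "\<exists>x\<in>A. v x = 1" using y SA by blast
  qed
  moreover have "H_end M d (zero_extend A M v) u \<le> 2 * e"
  proof (subst H_end_le_iff[OF zero_extend_fuzzy[OF fv] fu]; (intro conjI)?)
    show "0 \<le> 2 * e" using e by simp
    show "excess_le M d (zero_extend A M v) u (2 * e)"
      unfolding excess_le_def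
    proof (intro ballI allI impI)
      fix y \<epsilon> assume y: "y \<in> M" and \<epsilon>: "(0::real) < \<epsilon>"
      show "\<exists>z\<in>M. d y z + max 0 (zero_extend A M v y - u z) < 2 * e + \<epsilon>"
      proof (cases "y \<in> S")
        case True
        then have eq: "zero_extend A M v y = Sup (V y)" using SA y by (auto simp: zero_extend_def v_def)
        obtain t where "t \<in> V y" "Sup (V y) - e < t"
          using less_cSupD[of "V y" "Sup (V y) - e"] V_ne[OF y] e by auto
        then obtain z where "z \<in> M" "d z y < e" "Sup (V y) - e < u z" by (auto simp: V_def)
        then show ?thesis
          using eq e \<epsilon> by (intro bexI[of _ z]) (auto simp: commute[of y])
      next
        case False
        then have "zero_extend A M v y = 0" using y by (auto simp: zero_extend_def v_def)
        then show ?thesis using y e \<epsilon> fuzzy_setsD[OF fu y] by (intro bexI[of _ y]) auto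
      qed
    qed
    show "excess_le M d u (zero_extend A M v) (2 * e)"
      unfolding excess_le_def
    proof (intro ballI allI impI)
      fix x \<epsilon> assume x: "x \<in> M" and \<epsilon>: "(0::real) < \<epsilon>"
      show "\<exists>y\<in>M. d x y + max 0 (u x - zero_extend A M v y) < 2 * e + \<epsilon>"
      proof (cases "e \<le> u x")
        case True
        then obtain y where y: "y \<in> S" "d x y < e" using net x by blast
        then have "zero_extend A M v y = Sup (V y)" "y \<in> M"
          using SA subset by (auto simp: zero_extend_def v_def)
        then show ?thesis
          using V_ge[OF x y(2)] y e \<epsilon> by (intro bexI[of _ y]) auto
      next
        case False
        then have "u x - zero_extend A M v x \<le> e"
          using fuzzy_setsD[OF zero_extend_fuzzy[OF fv, of M] x] by linarith
        then show ?thesis using x e \<epsilon> by (intro bexI[of _ x]) auto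
      qed
    qed
  qed
  ultimately show ?thesis by blast
qed

end

theorem theorem8p9:
  fixes X Xt :: "'a set" and d dt :: "'a \<Rightarrow> 'a \<Rightarrow> real"
  assumes "X \<noteq> {}"
    and "is_completion_via (\<lambda>x. x) X d Xt dt"
  shows "is_completion_via (zero_extend X Xt)
           (F_USCB X d) (H_end X d) (F_USCG Xt dt) (H_end Xt dt)"
proof -
  have MX: "Metric_space X d" and MXt: "Metric_space Xt dt"
    and mc: "Metric_space.mcomplete Xt dt" and sub: "X \<subseteq> Xt"
    and deq: "\<And>x y. x \<in> X \<Longrightarrow> y \<in> X \<Longrightarrow> dt x y = d x y"
    and dense: "Metric_space.mtopology Xt dt closure_of X = Xt"
    using assms(2) unfolding is_completion_via_def by auto
  interpret X: Metric_space X d by fact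
  interpret T: Submetric Xt dt X
    using MXt sub by (simp add: Submetric_def Submetric_axioms_def)
  interpret G: Metric_space "F_USCG Xt dt" "H_end Xt dt" by (rule T.Metric_space_F_USCG)
  have top: "X.mtopology = T.sub.mtopology"
  proof -
    have "X.mball x r = T.sub.mball x r" for x r
      using deq by (auto simp: X.mball_def T.sub.mball_def)
    then have "X.mopen = T.sub.mopen"
      by (intro ext) (simp add: X.mopen_def T.sub.mopen_def)
    then show ?thesis by (simp add: X.mtopology_def T.sub.mtopology_def)
  qed
  have F_eq: "F_USCB X d = F_USCB X dt"
    by (simp add: F_USCB_def F_USC_def nonempty_closed_def nonempty_compact_def cut_def top)
  have B_fuzzy: "u \<in> fuzzy_sets X" if "u \<in> F_USCB X d" for u
    using that by (auto simp: F_USCB_def F_USC_def)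
  have iso: "H_end Xt dt (zero_extend X Xt u) (zero_extend X Xt v) = H_end X d u v"
    if "u \<in> F_USCB X d" "v \<in> F_USCB X d" for u v
  proof -
    \<comment> \<open>Outside \<open>X\<close> the functions \<open>d\<close> and \<open>dt\<close> may differ, but endographs in \<open>X\<close> never see that.\<close>
    have "hausdorff (sum_dist dt) (endograph X u) (endograph X v)
        = hausdorff (sum_dist d) (endograph X u) (endograph X v)"
    proof -
      have *: "sum_dist dt a b = sum_dist d a b" if "fst a \<in> X" "fst b \<in> X" for a b
        using that deq by (auto simp: sum_dist_def split: prod.splits)
      have "fst a \<in> X" if "a \<in> endograph X w" for a w
        using that by (auto simp: endograph_def)
      then show ?thesis unfolding hausdorff_def
        by (intro arg_cong2[where f=max] SUP_cong INF_cong refl arg_cong[where f=ennreal] *)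
    qed
    then have "H_end X dt u v = H_end X d u v" by (simp add: H_end_def)
    with T.H_end_zero_extend B_fuzzy that show ?thesis by metis
  qed
  have maps: "zero_extend X Xt \<in> F_USCB X d \<rightarrow> F_USCG Xt dt"
    using T.zero_extend_in_F_USCG F_eq by auto
  have "u \<in> G.mtopology closure_of (zero_extend X Xt ` F_USCB X d)" if u: "u \<in> F_USCG Xt dt" for u
    unfolding G.metric_closure_of
  proof (intro CollectI conjI u allI impI)
    fix r :: real assume "r > 0"
    then have "0 < min 1 (r/4)" "min 1 (r/4) \<le> 1" "2 * min 1 (r/4) < r" by auto
    then obtain v where v: "v \<in> F_USCB X d" "H_end Xt dt (zero_extend X Xt v) u < r"
      using T.finite_support_approximation[OF dense u, of "min 1 (r/4)"] unfolding F_eq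
      by (metis le_less_trans)
    then show "\<exists>w\<in>zero_extend X Xt ` F_USCB X d. w \<in> G.mball u r"
      using u maps by (auto simp: T.H_end_commute)
  qed
  then have "G.mtopology closure_of (zero_extend X Xt ` F_USCB X d) = F_USCG Xt dt"
    using closure_of_subset_topspace[of G.mtopology] by auto
  moreover have "Metric_space (F_USCB X d) (H_end X d)"
    by (rule Metric_space.subspace[OF X.Metric_space_H_end]) (auto simp: F_USCB_def)
  ultimately show ?thesis
    unfolding is_completion_via_def
    using G.Metric_space_axioms T.mcomplete_F_USCG[OF mc] maps iso by blast
qed

end
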